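(* Let $d\geq2$ and $\alpha\in]0,1[$. For each $j=1,\dots,d$ let $\delta_{j,\alpha/d}$ be a test of $H_{0,j}:\sigma_j^2=\sigma_{0,j}^2$ versus $H_{1,j}:\sigma_j^2>\sigma_{0,j}^2$ of level $\alpha/d$. Consider the test of $H_0=\bigcap_{j=1}^dH_{0,j}$ versus $H_1=\bigcup_{j=1}^dH_{1,j}$ which rejects $H_0$ if there exists $j\in\{1,\dots,d\}$ such that $\delta_{j,\alpha/d}$ rejects $H_{0,j}$. Then this test is of level $\alpha$: $$\mathbb{P}_{H_0}\left(\exists j\in\{1,\dots,d\},\ \delta_{j,\alpha/d}\text{ rejects }H_{0,j}\right)\leq\alpha .$$
   Context: Consider a $d$-dimensional SDE $dX_t=b_t\,dt+\Sigma\,dW_t$, $X_0=x_0$, with $W$ a $d$-dimensional Brownian motion and $\Sigma$ a constant diagonal matrix with diagonal entries $\sigma_1,\dots,\sigma_d$, observed at times $i\Delta$, $i=0,\dots,n$. Given positive constants $\sigma_{0,1},\dots,\sigma_{0,d}$, the model assumes $\sigma_j\geq\sigma_{0,j}$ for all $j$, and hypotheses are regarded as sets of probability distributions. A test is a decision rule based on the discrete observations; it is of level $\alpha$ if its probability of rejecting the null hypothesis, under any distribution in the null hypothesis, is at most $\alpha$. $\mathbb{P}_{H_0}$ denotes the probability under any distribution in $H_0$. *)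

theory Defs
  imports "HOL-Probability.Probability"
begin

section \<open>Brownian motion\<close>

text \<open>
  The library notion of filtration is indexed by all of \<open>real\<close>; only the times \<open>t \<ge> 0\<close> are used
  below, so the \<open>\<sigma>\<close>-algebras at negative times are irrelevant.
\<close>

definition filtration_on :: "'w measure \<Rightarrow> (real \<Rightarrow> 'w measure) \<Rightarrow> bool" where
  "filtration_on M F \<longleftrightarrow> filtration (space M) F \<and> (\<forall>t. sets (F t) \<subseteq> sets M)"

definition adapted :: "(real \<Rightarrow> 'w measure) \<Rightarrow> (real \<Rightarrow> 'w \<Rightarrow> real ^ 'd) \<Rightarrow> bool" where
  "adapted F X \<longleftrightarrow> (\<forall>t\<ge>0. X t \<in> borel_measurable (F t))"

definition progressive :: "(real \<Rightarrow> 'w measure) \<Rightarrow> (real \<Rightarrow> 'w \<Rightarrow> real ^ 'd) \<Rightarrow> bool" where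
  "progressive F b \<longleftrightarrow>
     (\<forall>t\<ge>0. (\<lambda>(s, w). b s w) \<in> borel_measurable (restrict_space borel {0..t} \<Otimes>\<^sub>M F t))"

definition brownian_motion ::
    "'w measure \<Rightarrow> (real \<Rightarrow> 'w measure) \<Rightarrow> (real \<Rightarrow> 'w \<Rightarrow> real ^ 'd) \<Rightarrow> bool" where
  "brownian_motion M F W \<longleftrightarrow>
     adapted F W \<and>
     (AE w in M. W 0 w = 0) \<and>
     (AE w in M. continuous_on {0..} (\<lambda>t. W t w)) \<and>
     (\<forall>s\<ge>0. \<forall>t>s.
        prob_space.indep_set M
          {(\<lambda>w. W t w - W s w) -` A \<inter> space M | A. A \<in> sets borel} (sets (F s)) \<and>
        prob_space.indep_vars M (\<lambda>_. borel) (\<lambda>j w. (W t w - W s w) $ j) UNIV \<and>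
        (\<forall>j. distributed M lborel (\<lambda>w. (W t w - W s w) $ j)
               (\<lambda>x. ennreal (normal_density 0 (sqrt (t - s)) x))))"

section \<open>The stochastic differential equation\<close>

definition diag_matrix :: "real ^ 'd \<Rightarrow> real ^ 'd ^ 'd" where
  "diag_matrix \<sigma> = (\<chi> i j. if i = j then \<sigma> $ i else 0)"

text \<open>
  \<open>X\<close> solves \<open>dX = b dt + \<Sigma> dW\<close>, \<open>X 0 = x0\<close>. As \<open>\<Sigma>\<close> is constant, the stochastic integral of \<open>\<Sigma>\<close>
  against \<open>W\<close> over \<open>[0, t]\<close> is \<open>\<Sigma> (W t - W 0)\<close>, and \<open>W 0 = 0\<close> almost surely.
\<close>

definition sde_solution ::
    "'w measure \<Rightarrow> (real \<Rightarrow> 'w measure) \<Rightarrow> (real \<Rightarrow> 'w \<Rightarrow> real ^ 'd) \<Rightarrow> (real \<Rightarrow> 'w \<Rightarrow> real ^ 'd)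
       \<Rightarrow> real ^ 'd ^ 'd \<Rightarrow> real ^ 'd \<Rightarrow> (real \<Rightarrow> 'w \<Rightarrow> real ^ 'd) \<Rightarrow> bool" where
  "sde_solution M F W b \<Sigma> x0 X \<longleftrightarrow>
     prob_space M \<and> filtration_on M F \<and> brownian_motion M F W \<and>
     progressive F b \<and>
     (AE w in M. \<forall>t\<ge>0. set_integrable lborel {0..t} (\<lambda>s. b s w)) \<and>
     adapted F X \<and>
     (AE w in M. \<forall>t\<ge>0. X t w = x0 + (LINT s:{0..t}|lborel. b s w) + \<Sigma> *v W t w)"

definition path_space :: "(real \<Rightarrow> real ^ 'd) measure" where
  "path_space = PiM {0..} (\<lambda>_. borel)"

definition path_law :: "'w measure \<Rightarrow> (real \<Rightarrow> 'w \<Rightarrow> real ^ 'd) \<Rightarrow> (real \<Rightarrow> real ^ 'd) measure" where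
  "path_law M X = distr M path_space (\<lambda>w. \<lambda>t\<in>{0..}. X t w)"

text \<open>
  \<open>\<B>\<close> is the class of drift processes allowed by the model (\<open>UNIV\<close> for no restriction, a singleton
  for a given drift). Its type also fixes the type of the sample spaces carrying the solutions.
\<close>

definition diffusion_laws ::
    "(real \<Rightarrow> 'w \<Rightarrow> real ^ 'd) set \<Rightarrow> real ^ 'd \<Rightarrow> real ^ 'd \<Rightarrow> (real \<Rightarrow> real ^ 'd) measure set" where
  "diffusion_laws \<B> x0 \<sigma> =
     {path_law M X | M F W b X. b \<in> \<B> \<and> sde_solution M F W b (diag_matrix \<sigma>) x0 X}"

section \<open>Hypotheses and tests\<close>

text \<open>
  Hypotheses are sets of laws on path space. In both \<open>null_hyp\<close> and \<open>alt_hyp\<close> the coordinates other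
  than \<open>j\<close> only satisfy the standing model assumption \<open>\<sigma> $ k \<ge> \<sigma>0 $ k\<close>.
\<close>

definition null_hyp ::
    "(real \<Rightarrow> 'w \<Rightarrow> real ^ 'd) set \<Rightarrow> real ^ 'd \<Rightarrow> real ^ 'd \<Rightarrow> 'd \<Rightarrow> (real \<Rightarrow> real ^ 'd) measure set" where
  "null_hyp \<B> x0 \<sigma>0 j =
     (\<Union>\<sigma> \<in> {\<sigma>. (\<forall>k. \<sigma> $ k \<ge> \<sigma>0 $ k) \<and> (\<sigma> $ j)\<^sup>2 = (\<sigma>0 $ j)\<^sup>2}. diffusion_laws \<B> x0 \<sigma>)"

definition alt_hyp ::
    "(real \<Rightarrow> 'w \<Rightarrow> real ^ 'd) set \<Rightarrow> real ^ 'd \<Rightarrow> real ^ 'd \<Rightarrow> 'd \<Rightarrow> (real \<Rightarrow> real ^ 'd) measure set" where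
  "alt_hyp \<B> x0 \<sigma>0 j =
     (\<Union>\<sigma> \<in> {\<sigma>. (\<forall>k. \<sigma> $ k \<ge> \<sigma>0 $ k) \<and> (\<sigma> $ j)\<^sup>2 > (\<sigma>0 $ j)\<^sup>2}. diffusion_laws \<B> x0 \<sigma>)"

definition observations :: "nat \<Rightarrow> real \<Rightarrow> (real \<Rightarrow> real ^ 'd) \<Rightarrow> nat \<Rightarrow> real ^ 'd" where
  "observations n \<Delta> x = (\<lambda>i\<in>{0..n}. x (real i * \<Delta>))"

definition observation_space :: "nat \<Rightarrow> (nat \<Rightarrow> real ^ 'd) measure" where
  "observation_space n = PiM {0..n} (\<lambda>_. borel)"

text \<open>
  A test is a measurable decision rule on the observations; the value \<open>True\<close> means rejection of the
  null hypothesis. The alternative \<open>H1\<close> is part of the testing problem but plays no role in the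
  level.
\<close>

definition is_test :: "nat \<Rightarrow> ((nat \<Rightarrow> real ^ 'd) \<Rightarrow> bool) \<Rightarrow> bool" where
  "is_test n \<delta> \<longleftrightarrow> \<delta> \<in> measurable (observation_space n) (count_space UNIV)"

definition test_of_level ::
    "nat \<Rightarrow> real \<Rightarrow> (real \<Rightarrow> real ^ 'd) measure set \<Rightarrow> (real \<Rightarrow> real ^ 'd) measure set
       \<Rightarrow> real \<Rightarrow> ((nat \<Rightarrow> real ^ 'd) \<Rightarrow> bool) \<Rightarrow> bool" where
  "test_of_level n \<Delta> H0 H1 \<alpha> \<delta> \<longleftrightarrow>
     is_test n \<delta> \<and> (\<forall>P\<in>H0. measure P {x \<in> space P. \<delta> (observations n \<Delta> x)} \<le> \<alpha>)"

end

theory Submission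
  imports Defs
begin

text \<open>This is the Bonferroni correction. A law in the intersection of the null hypotheses lies
  in each of them, so under it every individual test rejects with probability at most \<alpha>/d.
  The combined rejection region is the union of the d individual ones, and subadditivity bounds its
  probability by d * \<alpha>/d = \<alpha>, whatever the dependence between the tests. What remains
  is measurability: \<open>sets_rejection_region\<close> makes each region an event, and
  \<open>test_of_level_union_bound\<close> does the summation.\<close>

lemma measurable_observations:
  assumes "\<Delta> \<ge> 0"
  shows "observations n \<Delta> \<in> measurable path_space (observation_space n)"
  unfolding observations_def path_space_def observation_space_def
  \<comment> \<open>The sign of \<open>\<Delta>\<close> puts every time
    \<open>real i * \<Delta>\<close> in the index set \<open>{0..}\<close>, so each observation is a
    coordinate projection.\<close>
  using assms by (intro measurable_restrict measurable_component_singleton) auto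

lemma is_test_exists:
  fixes \<delta> :: "'i::finite \<Rightarrow> (nat \<Rightarrow> real ^ 'd) \<Rightarrow> bool"
  assumes "\<And>j. is_test n (\<delta> j)"
  shows "is_test n (\<lambda>y. \<exists>j. \<delta> j y)"
  using assms unfolding is_test_def by measurable

lemma sets_rejection_region:
  assumes "is_test n \<delta>" and "\<Delta> \<ge> 0" and "sets P = sets path_space"
  shows "{x \<in> space P. \<delta> (observations n \<Delta> x)} \<in> sets P"
proof -
  have "(\<lambda>x. \<delta> (observations n \<Delta> x)) \<in> measurable path_space (count_space UNIV)"
    using assms(1) measurable_observations[OF assms(2)] unfolding is_test_def
    by (rule measurable_compose_rev)
  then have "(\<lambda>x. \<delta> (observations n \<Delta> x)) \<in> measurable P (count_space UNIV)"
    using measurable_cong_sets[OF assms(3) refl] by blast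
  then show ?thesis
    by simp
qed

lemma sets_null_hyp:
  assumes "P \<in> null_hyp \<B> x0 \<sigma>0 j"
  shows "sets P = sets path_space"
  using assms by (auto simp: null_hyp_def diffusion_laws_def path_law_def)

text \<open>The diffusion model enters only through the \<sigma>-algebra carried by its laws, so the
  bound is proved for arbitrary families of hypotheses.\<close>

lemma test_of_level_union_bound:
  fixes \<delta> :: "'i::finite \<Rightarrow> (nat \<Rightarrow> real ^ 'd) \<Rightarrow> bool"
  assumes level: "\<And>j. test_of_level n \<Delta> (H0 j) (H1 j) (\<alpha> / real CARD('i)) (\<delta> j)"
    and "\<Delta> \<ge> 0"
    and sets: "\<And>P j. P \<in> H0 j \<Longrightarrow> sets P = sets path_space"
  shows "test_of_level n \<Delta> (\<Inter>j. H0 j) (\<Union>j. H1 j) \<alpha> (\<lambda>y. \<exists>j. \<delta> j y)"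
  unfolding test_of_level_def
proof (intro conjI ballI)
  have test: "is_test n (\<delta> j)" for j
    using level[of j] by (simp add: test_of_level_def)
  then show "is_test n (\<lambda>y. \<exists>j. \<delta> j y)"
    by (rule is_test_exists)
  fix P assume P: "P \<in> (\<Inter>j. H0 j)"
  let ?R = "\<lambda>j. {x \<in> space P. \<delta> j (observations n \<Delta> x)}"
  have "{x \<in> space P. \<exists>j. \<delta> j (observations n \<Delta> x)} = (\<Union>j. ?R j)"
    by auto
  \<comment> \<open>Subadditivity of \<open>measure\<close> survives infinite mass, which is read as
    0: a union of finite measure has only pieces of finite measure.\<close>
  also have "measure P \<dots> \<le> (\<Sum>j\<in>UNIV. measure P (?R j))"
    using P by (intro measure_UNION_le sets_rejection_region test assms(2) sets) auto
  \<comment> \<open>Membership of \<open>P\<close> in every \<open>H0 j\<close> lets all the level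
    bounds apply to this one law.\<close>
  also have "\<dots> \<le> (\<Sum>j\<in>(UNIV :: 'i set). \<alpha> / real CARD('i))"
    using level P by (intro sum_mono) (auto simp: test_of_level_def)
  also have "\<dots> = \<alpha>"
    by simp
  finally show "measure P {x \<in> space P. \<exists>j. \<delta> j (observations n \<Delta> x)} \<le> \<alpha>" .
qed

theorem mainTheorem7:
  fixes \<B> :: "(real \<Rightarrow> 'w \<Rightarrow> real ^ 'd) set"
    and x0 \<sigma>0 :: "real ^ 'd"
    and n :: nat and \<Delta> \<alpha> :: real
    and \<delta> :: "'d \<Rightarrow> (nat \<Rightarrow> real ^ 'd) \<Rightarrow> bool"
  assumes "CARD('d) \<ge> 2"
    and "0 < \<alpha>" and "\<alpha> < 1"
    and "\<Delta> > 0"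
    and "\<And>j. \<sigma>0 $ j > 0"
    and "\<And>j. test_of_level n \<Delta> (null_hyp \<B> x0 \<sigma>0 j) (alt_hyp \<B> x0 \<sigma>0 j) (\<alpha> / real CARD('d)) (\<delta> j)"
  shows "test_of_level n \<Delta> (\<Inter>j. null_hyp \<B> x0 \<sigma>0 j) (\<Union>j. alt_hyp \<B> x0 \<sigma>0 j) \<alpha> (\<lambda>y. \<exists>j. \<delta> j y)"
  using assms by (intro test_of_level_union_bound) (auto simp: less_imp_le dest: sets_null_hyp)

end
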